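(* Let $F_2$ and $F_3$ be finite subsets of $\mathbb{Z}^2$ with the same line sums (the same row sum in every row and the same column sum in every column). Let $F_1$ be a uniquely determined neighbour of $F_2$ and $F_3$. Put $\alpha = \alpha(F_2, F_1)$. Then $$|F_2 \bigtriangleup F_3| \leq 2 \alpha \sqrt{8|F_2| + 1} - 2 \alpha.$$
   Context: For $F$ a finite subset of $\mathbb{Z}^2$, the row sum of row $i\in\mathbb{Z}$ is the number of $j \in \mathbb{Z}$ with $(i,j)\in F$, and the column sum of column $j\in\mathbb{Z}$ is the number of $i \in \mathbb{Z}$ with $(i,j)\in F$. The row and column sums together are called the line sums of $F$. A finite set $F\subset\mathbb{Z}^2$ is called uniquely determined (by its line sums) if every subset $F'$ of $\mathbb{Z}^2$ with exactly the same row and column sums as $F$ equals $F$. For finite $F, G\subset \mathbb{Z}^2$ with row sums $r_i^{F}, r_i^{G}$ ($i\in\mathbb{Z}$) and column sums $c_j^{F}, c_j^{G}$ ($j\in\mathbb{Z}$), define $$\alpha(F,G)=\frac12\Big(\sum_{j\in\mathbb{Z}}|c_j^{F}-c_j^{G}|+\sum_{i\in\mathbb{Z}}|r_i^{F}-r_i^{G}|\Big).$$ Uniquely determined neighbour: let $G$ be a finite subset of $\mathbb{Z}^2$ with column sums $c_j$, and let $C$ be a finite set of $n$ column indices containing every column with non-zero column sum of $G$. A set $F_1$ is a uniquely determined neighbour of $G$ if $F_1$ is a finite uniquely determined set, $F_1$ has the same row sum as $G$ in every row, all columns of $F_1$ with index outside $C$ are empty, and there is an enumeration $\sigma(1),\ldots,\sigma(n)$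 of $C$ with $c_{\sigma(1)}\ge c_{\sigma(2)}\ge\ldots\ge c_{\sigma(n)}$ such that the column sums $v_j$ of $F_1$ satisfy $v_{\sigma(1)}\ge v_{\sigma(2)}\ge\ldots\ge v_{\sigma(n)}$. (This depends only on the line sums of $G$ and not on the choice of $C$.) $\bigtriangleup$ denotes symmetric difference. *)

theory Defs
  imports Complex_Main "HOL-Library.Groups_Big_Fun"
begin

definition row :: "(int \<times> int) set \<Rightarrow> int \<Rightarrow> int set" where
  "row F i = {j. (i, j) \<in> F}"

definition col :: "(int \<times> int) set \<Rightarrow> int \<Rightarrow> int set" where
  "col F j = {i. (i, j) \<in> F}"

(* card is 0 on infinite sets, so these are the true counts only if the line is finite. *)

definition row_sum :: "(int \<times> int) set \<Rightarrow> int \<Rightarrow> nat" where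
  "row_sum F i = card (row F i)"

definition col_sum :: "(int \<times> int) set \<Rightarrow> int \<Rightarrow> nat" where
  "col_sum F j = card (col F j)"

definition same_line_sums :: "(int \<times> int) set \<Rightarrow> (int \<times> int) set \<Rightarrow> bool" where
  "same_line_sums F G \<longleftrightarrow>
     (\<forall>i. row_sum F i = row_sum G i) \<and> (\<forall>j. col_sum F j = col_sum G j)"

(* The competitor F' is an arbitrary subset of the plane. An infinite line has no finite count and
   cannot match a line of the finite set F; the finiteness premises exclude such lines, which
   card would otherwise treat as having line sum 0. *)
definition uniquely_determined :: "(int \<times> int) set \<Rightarrow> bool" where
  "uniquely_determined F \<longleftrightarrow>
     finite F \<and>
     (\<forall>F'. (\<forall>i. finite (row F' i)) \<longrightarrow> (\<forall>j. finite (col F' j)) \<longrightarrow>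
           same_line_sums F' F \<longrightarrow> F' = F)"

(* Sum_any sums over the support, which is finite here for finite F and G. *)
definition alpha :: "(int \<times> int) set \<Rightarrow> (int \<times> int) set \<Rightarrow> real" where
  "alpha F G =
     (Sum_any (\<lambda>j. \<bar>real (col_sum F j) - real (col_sum G j)\<bar>) +
      Sum_any (\<lambda>i. \<bar>real (row_sum F i) - real (row_sum G i)\<bar>)) / 2"

(* The relation does not depend on the finite index set C, as long as C contains all non-empty
   columns of G; hence C is quantified existentially. *)
definition ud_neighbour :: "(int \<times> int) set \<Rightarrow> (int \<times> int) set \<Rightarrow> bool" where
  "ud_neighbour F1 G \<longleftrightarrow>
     finite G \<and> uniquely_determined F1 \<and>
     (\<forall>i. row_sum F1 i = row_sum G i) \<and>
     (\<exists>C. finite C \<and> {j. col_sum G j \<noteq> 0} \<subseteq> C \<and>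
          (\<forall>j. j \<notin> C \<longrightarrow> col F1 j = {}) \<and>
          (\<exists>\<sigma>. bij_betw \<sigma> {1..card C} C \<and>
               antimono_on {1..card C} (\<lambda>k. col_sum G (\<sigma> k)) \<and>
               antimono_on {1..card C} (\<lambda>k. col_sum F1 (\<sigma> k))))"

end

theory Submission
  imports Defs
begin

text \<open>
  It suffices to bound \<open>sym_diff F F1\<close> for uniquely determined \<open>F1\<close> and \<open>F\<close> with the same row
  sums, and then to use the triangle inequality through \<open>F1\<close>. As \<open>F1\<close> admits no switching, its
  columns form a chain under inclusion. Give column \<open>j\<close> the height \<open>h j\<close>, the number of distinct
  non-zero column sums of \<open>F1\<close> exceeding that of column \<open>j\<close>. If a row contains a point of
  \<open>F1 - F\<close> in column \<open>j\<close> and a point of \<open>F - F1\<close> in column \<open>k\<close>, then \<open>h k \<ge> h j + 1\<close>; pairing such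
  points row by row gives \<open>card (F1 - F) \<le> (\<Sum>j. h j * (c j - v j)) \<le> m * alpha F F1\<close>, where \<open>c\<close>
  and \<open>v\<close> are the column sums of \<open>F\<close> and \<open>F1\<close> and \<open>m\<close> is the number of distinct non-zero values of
  \<open>v\<close>. Finally \<open>m (m + 1) / 2 \<le> card F1\<close>, since these values are distinct positive integers.
\<close>

lemma finite_row: "finite F \<Longrightarrow> finite (row F i)"
  by (rule finite_subset[of _ "snd ` F"]) (force simp: row_def)+

lemma finite_col: "finite F \<Longrightarrow> finite (col F j)"
  by (rule finite_subset[of _ "fst ` F"]) (force simp: col_def)+

lemma sum_by_rows:
  assumes "finite I" "finite J" "F \<subseteq> I \<times> J"
  shows "(\<Sum>p\<in>F. g p) = (\<Sum>i\<in>I. \<Sum>j\<in>row F i. g (i, j))"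
proof -
  have "finite F" using assms finite_subset by blast
  moreover have "F = Sigma I (row F)" using assms(3) by (auto simp: row_def)
  ultimately show ?thesis
    using sum.Sigma[of I "row F" "\<lambda>i j. g (i, j)"] assms(1) by (simp add: finite_row)
qed

lemma sum_by_cols:
  assumes "finite I" "finite J" "F \<subseteq> I \<times> J"
  shows "(\<Sum>p\<in>F. g p) = (\<Sum>j\<in>J. \<Sum>i\<in>col F j. g (i, j))"
proof -
  have fin: "finite F" using assms finite_subset by blast
  have eq: "F = prod.swap ` Sigma J (col F)" using assms(3) by (force simp: col_def)
  have "(\<Sum>p\<in>F. g p) = (\<Sum>q\<in>Sigma J (col F). g (prod.swap q))"
    by (subst eq, subst sum.reindex) auto
  also have "\<dots> = (\<Sum>j\<in>J. \<Sum>i\<in>col F j. g (i, j))"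
    using sum.Sigma[of J "col F" "\<lambda>j i. g (i, j)"] assms(2) fin
    by (simp add: finite_col split_def prod.swap_def)
  finally show ?thesis .
qed

lemma finite_subset_box:
  assumes "finite (F :: (int \<times> int) set)" "finite G"
  obtains I J where "finite I" "finite J" "F \<subseteq> I \<times> J" "G \<subseteq> I \<times> J"
proof (rule that)
  show "F \<subseteq> fst ` (F \<union> G) \<times> snd ` (F \<union> G)" "G \<subseteq> fst ` (F \<union> G) \<times> snd ` (F \<union> G)"
    by force+
qed (use assms in auto)

lemma card_eq_of_row_sums:
  assumes "finite F" "finite G" "\<And>i. row_sum F i = row_sum G i"
  shows "card F = card G"
proof -
  obtain I J where "finite I" "finite J" "F \<subseteq> I \<times> J" "G \<subseteq> I \<times> J"
    using finite_subset_box assms(1,2) by metis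
  then show ?thesis
    using sum_by_rows[of I J F "\<lambda>_. 1::nat"] sum_by_rows[of I J G "\<lambda>_. 1::nat"] assms(3)
    by (simp add: row_sum_def)
qed

text \<open>Otherwise, trading the diagonal corners \<open>(i, j)\<close>, \<open>(i', j')\<close>
  of a rectangle for the other two changes \<open>F\<close> but no line sum.\<close>

lemma uniquely_determined_no_switch:
  assumes ud: "uniquely_determined F"
    and "(i, j) \<in> F" "(i', j') \<in> F" "(i, j') \<notin> F"
  shows "(i', j) \<in> F"
proof (rule ccontr)
  assume n: "(i', j) \<notin> F"
  define F' where "F' = (F - {(i, j), (i', j')}) \<union> {(i, j'), (i', j)}"
  have fin: "finite F" using ud by (simp add: uniquely_determined_def)
  have ij: "i \<noteq> i'" "j \<noteq> j'" using assms n by auto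
  have exch: "card (insert b (A - {a})) = card A" if "finite A" "a \<in> A" "b \<notin> A" for a b and A :: "int set"
    using that card_Suc_Diff1[of A a] by simp
  have mem_row: "b \<in> row F a \<longleftrightarrow> (a, b) \<in> F" and mem_col: "a \<in> col F b \<longleftrightarrow> (a, b) \<in> F" for a b
    by (simp_all add: row_def col_def)
  have "row F' k = (if k = i then insert j' (row F i - {j})
      else if k = i' then insert j (row F i' - {j'}) else row F k)" for k
    using ij by (auto simp: row_def F'_def)
  then have r: "row_sum F' k = row_sum F k" for k
    using ij exch[OF finite_row[OF fin], of j i j'] exch[OF finite_row[OF fin], of j' i' j]
      assms(2-4) n by (simp add: row_sum_def mem_row)
  have "col F' k = (if k = j then insert i' (col F j - {i})
      else if k = j' then insert i (col F j' - {i'}) else col F k)" for k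
    using ij by (auto simp: col_def F'_def)
  then have c: "col_sum F' k = col_sum F k" for k
    using ij exch[OF finite_col[OF fin], of i j i'] exch[OF finite_col[OF fin], of i' j' i]
      assms(2-4) n by (simp add: col_sum_def mem_col)
  have "finite F'" using fin by (simp add: F'_def)
  then have "F' = F"
    using ud r c unfolding uniquely_determined_def same_line_sums_def
    by (metis finite_row finite_col)
  then show False using n by (auto simp: F'_def)
qed

text \<open>Absence of switchings forces \<open>col F j'\<close> into \<open>col F j\<close>; row
  \<open>i\<close> makes the inclusion strict.\<close>

lemma uniquely_determined_col_sum_less:
  assumes ud: "uniquely_determined F" and "(i, j) \<in> F" "(i, j') \<notin> F"
  shows "col_sum F j' < col_sum F j"
proof -
  have "finite (col F j)" using ud by (simp add: uniquely_determined_def finite_col)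
  moreover have "col F j' \<subset> col F j"
    using uniquely_determined_no_switch[OF ud assms(2) _ assms(3)] assms(2,3)
    by (auto simp: col_def)
  ultimately show ?thesis unfolding col_sum_def by (rule psubset_card_mono)
qed

lemma triangular_le_sum_positive:
  fixes S :: "nat set"
  assumes "finite S" "0 \<notin> S"
  shows "card S * (card S + 1) \<le> 2 * \<Sum>S"
  using assms
proof (induction rule: finite_linorder_max_induct)
  \<comment> \<open>The new maximum \<open>b\<close> is at least \<open>card A + 1\<close>, and
    \<open>2 * (card A + 1)\<close> is exactly the growth of the left-hand side.\<close>
  case (insert b A)
  have "A \<subseteq> {1..<b}" using insert by (force simp: Suc_le_eq intro: gr0I)
  then have "card A \<le> b - 1" using card_mono[of "{1..<b}" A] by simp
  moreover have "b \<notin> A" "b > 0" using insert by auto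
  ultimately show ?case using insert by simp
qed simp

text \<open>Any bijection from \<open>A - B\<close> to \<open>B - A\<close> gains weight at least 1
  per point, and \<open>A \<inter> B\<close> cancels. It serves to compare a row of
  \<open>F1\<close> with the same row of \<open>F\<close>.\<close>

lemma card_le_weight_diff:
  fixes h :: "'a \<Rightarrow> real"
  assumes "finite A" "finite B" "card A = card B"
    and sep: "\<And>a b. a \<in> A - B \<Longrightarrow> b \<in> B - A \<Longrightarrow> h a + 1 \<le> h b"
  shows "real (card (A - B)) \<le> sum h B - sum h A"
proof -
  have "card (A - B) = card (B - A)"
    using assms(1-3) by (simp add: card_Diff_subset_Int Int_commute)
  then obtain f where f: "bij_betw f (A - B) (B - A)"
    using finite_same_card_bij assms(1,2) by blast
  have "real (card (A - B)) = (\<Sum>a\<in>A - B. 1)" by simp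
  also have "\<dots> \<le> (\<Sum>a\<in>A - B. h (f a) - h a)"
    using sep f by (intro sum_mono) (fastforce dest: bij_betwE)
  also have "\<dots> = sum h (B - A) - sum h (A - B)"
    using sum.reindex_bij_betw[OF f, of h] by (simp add: sum_subtractf)
  also have "\<dots> = sum h B - sum h A"
    using sum.Int_Diff[OF assms(1), of h B] sum.Int_Diff[OF assms(2), of h A]
    by (simp add: Int_commute)
  finally show ?thesis .
qed

lemma alpha_eq_sum_cols:
  assumes "finite J" "F \<subseteq> I \<times> J" "G \<subseteq> I \<times> J" "\<And>i. row_sum F i = row_sum G i"
  shows "alpha F G = (\<Sum>j\<in>J. \<bar>real (col_sum F j) - real (col_sum G j)\<bar>) / 2"
proof -
  have "col F j = {}" "col G j = {}" if "j \<notin> J" for j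
    using that assms(2,3) by (auto simp: col_def)
  then have "{j. \<bar>real (col_sum F j) - real (col_sum G j)\<bar> \<noteq> 0} \<subseteq> J"
    by (force simp: col_sum_def)
  then show ?thesis
    using Sum_any.expand_superset[OF assms(1), of "\<lambda>j. \<bar>real (col_sum F j) - real (col_sum G j)\<bar>"]
    by (simp add: alpha_def assms(4))
qed

lemma card_sym_diff_uniquely_determined_le:
  assumes finF: "finite F" and ud: "uniquely_determined F1"
    and rows: "\<And>i. row_sum F i = row_sum F1 i"
  shows "real (card (sym_diff F F1)) \<le> alpha F F1 * (sqrt (8 * real (card F) + 1) - 1)"
proof -
  have finF1: "finite F1" using ud by (simp add: uniquely_determined_def)
  obtain I J where IJ: "finite I" "finite J" and F: "F \<subseteq> I \<times> J" and F1: "F1 \<subseteq> I \<times> J"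
    using finite_subset_box finF finF1 by metis
  have cardF: "card F = card F1" by (rule card_eq_of_row_sums[OF finF finF1 rows])
  \<comment> \<open>Dropping 0 makes the triangular bound applicable to \<open>S\<close>.\<close>
  define S where "S = col_sum F1 ` J - {0}"
  define m where "m = card S"
  define h where "h j = real (card {s \<in> S. col_sum F1 j < s})" for j
  define d where "d j = real (col_sum F j) - real (col_sum F1 j)" for j
  have finS: "finite S" using IJ by (simp add: S_def)
  have h_le: "h j \<le> m" for j
    unfolding h_def m_def using finS by (auto intro: card_mono)
  have h_less: "h j + 1 \<le> h k" if "(i, j) \<in> F1" "(i, k) \<notin> F1" for i j k
  proof -
    have "col_sum F1 k < col_sum F1 j"
      using uniquely_determined_col_sum_less[OF ud that] .
    \<comment> \<open>This value exceeds another column sum, so it is non-zero; it is counted in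
      \<open>h k\<close> but not in \<open>h j\<close>.\<close>
    moreover have "col_sum F1 j \<in> S"
      using that(1) F1 calculation by (auto simp: S_def)
    ultimately have "{s \<in> S. col_sum F1 j < s} \<subset> {s \<in> S. col_sum F1 k < s}" by auto
    then have "card {s \<in> S. col_sum F1 j < s} < card {s \<in> S. col_sum F1 k < s}"
      using finS by (intro psubset_card_mono) auto
    then show ?thesis by (simp add: h_def)
  qed
  have cols: "(\<Sum>p\<in>G. w (snd p)) = (\<Sum>j\<in>J. w j * real (col_sum G j))"
    if "G \<subseteq> I \<times> J" for G and w :: "int \<Rightarrow> real"
    using sum_by_cols[OF IJ that, of "\<lambda>p. w (snd p)"] by (simp add: col_sum_def mult.commute)
  have weights: "(\<Sum>p\<in>F. w (snd p)) - (\<Sum>p\<in>F1. w (snd p)) = (\<Sum>j\<in>J. w j * d j)"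
    for w :: "int \<Rightarrow> real"
    by (simp add: cols F F1 d_def right_diff_distrib sum_subtractf)
  have "real (card (F1 - F)) = (\<Sum>i\<in>I. real (card (row F1 i - row F i)))"
  proof -
    have "row (F1 - F) i = row F1 i - row F i" for i by (auto simp: row_def)
    then show ?thesis
      using sum_by_rows[OF IJ, of "F1 - F" "\<lambda>_. 1::real"] F1 by auto
  qed
  also have "\<dots> \<le> (\<Sum>i\<in>I. sum h (row F i) - sum h (row F1 i))"
    using rows
    by (intro sum_mono card_le_weight_diff finite_row finF finF1)
      (auto simp: row_def row_sum_def intro: h_less)
  \<comment> \<open>Double counting: the weight of a point depends only on its column, so the row
    totals regroup by columns.\<close>
  also have "\<dots> = (\<Sum>j\<in>J. h j * d j)"
    unfolding weights[symmetric]
    by (simp add: sum_subtractf sum_by_rows[OF IJ F] sum_by_rows[OF IJ F1])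
  \<comment> \<open>The differences \<open>d\<close> sum to \<open>0\<close>, so the heights may be centred; this gains a factor \<open>2\<close>.\<close>
  also have "\<dots> = (\<Sum>j\<in>J. (h j - m / 2) * d j)"
    using weights[of "\<lambda>_. m / 2"] cardF by (simp add: left_diff_distrib sum_subtractf)
  also have "\<dots> \<le> (\<Sum>j\<in>J. m / 2 * \<bar>d j\<bar>)"
  proof (rule sum_mono)
    fix j
    have "\<bar>h j - m / 2\<bar> \<le> m / 2" using h_le[of j] by (auto simp: h_def abs_le_iff field_simps)
    then have "\<bar>h j - m / 2\<bar> * \<bar>d j\<bar> \<le> m / 2 * \<bar>d j\<bar>" by (rule mult_right_mono) simp
    then show "(h j - m / 2) * d j \<le> m / 2 * \<bar>d j\<bar>"
      by (metis abs_ge_self abs_mult order_trans)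
  qed
  \<comment> \<open>The row part of \<open>alpha\<close> vanishes, and its factor 1/2 absorbs the
    one in \<open>m / 2\<close>.\<close>
  also have "\<dots> = m * alpha F F1"
    using alpha_eq_sum_cols[OF IJ(2) F F1 rows]
    by (simp add: d_def sum_distrib_left sum_divide_distrib)
  finally have half: "real (card (F1 - F)) \<le> m * alpha F F1" .

  have "card (F - F1) = card (F1 - F)"
    using finF finF1 cardF by (simp add: card_Diff_subset_Int Int_commute)
  then have "real (card (sym_diff F F1)) = 2 * real (card (F1 - F))"
    using finF finF1 by (subst card_Un_disjoint) auto
  also have "\<dots> \<le> alpha F F1 * (2 * real m)" using half by (simp add: mult.commute)
  also have "\<dots> \<le> alpha F F1 * (sqrt (8 * real (card F) + 1) - 1)"
  proof (rule mult_left_mono)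
    have "m * (m + 1) \<le> 2 * \<Sum>S"
      unfolding m_def using finS by (rule triangular_le_sum_positive) (simp add: S_def)
    also have "\<Sum>S \<le> \<Sum>(col_sum F1 ` J)"
      using IJ by (intro sum_mono2) (auto simp: S_def)
    also have "\<dots> \<le> (\<Sum>j\<in>J. col_sum F1 j)"
      using sum_image_le[OF IJ(2), of "\<lambda>x. x" "col_sum F1"] by (simp add: o_def)
    also have "\<dots> = card F"
      using sum_by_cols[OF IJ F1, of "\<lambda>_. 1::nat"] cardF by (simp add: col_sum_def)
    finally have "m * (m + 1) \<le> 2 * card F" by simp
    then have "real m * (real m + 1) \<le> 2 * real (card F)"
      using of_nat_mono[where 'a = real, OF \<open>m * (m + 1) \<le> 2 * card F\<close>] by (simp add: algebra_simps)
    \<comment> \<open>Completing the square: the left side is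
      \<open>4 * m * (m + 1) + 1\<close>.\<close>
    then have "(2 * real m + 1)\<^sup>2 \<le> 8 * real (card F) + 1"
      by (simp add: power2_eq_square algebra_simps)
    then show "2 * real m \<le> sqrt (8 * real (card F) + 1) - 1"
      using real_le_rsqrt[of "2 * real m + 1" "8 * real (card F) + 1"] by simp
    show "0 \<le> alpha F F1"
      unfolding alpha_eq_sum_cols[OF IJ(2) F F1 rows] by (simp add: sum_nonneg)
  qed
  finally show ?thesis .
qed

theorem theorem2:
  fixes F1 F2 F3 :: "(int \<times> int) set"
  assumes "finite F2" and "finite F3"
    and "same_line_sums F2 F3"
    and "ud_neighbour F1 F2" and "ud_neighbour F1 F3"
  shows "real (card (sym_diff F2 F3))
           \<le> 2 * alpha F2 F1 * sqrt (8 * real (card F2) + 1) - 2 * alpha F2 F1"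
proof -
  have ud: "uniquely_determined F1"
    and rows: "\<And>i. row_sum F2 i = row_sum F1 i" "\<And>i. row_sum F3 i = row_sum F1 i"
    using assms(4,5) by (simp_all add: ud_neighbour_def)
  have finF1: "finite F1" using ud by (simp add: uniquely_determined_def)
  \<comment> \<open>Both quantities depend only on line sums, so one bound covers \<open>F2\<close>
    and \<open>F3\<close>.\<close>
  have "alpha F3 F1 = alpha F2 F1" "card F3 = card F2"
    using assms(3) card_eq_of_row_sums[OF assms(1,2)]
    by (simp_all add: alpha_def same_line_sums_def)
  then have "real (card (sym_diff F2 F1)) + real (card (sym_diff F3 F1))
      \<le> 2 * (alpha F2 F1 * (sqrt (8 * real (card F2) + 1) - 1))"
    using card_sym_diff_uniquely_determined_le[OF assms(1) ud rows(1)]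
      card_sym_diff_uniquely_determined_le[OF assms(2) ud rows(2)] by simp
  moreover have "card (sym_diff F2 F3) \<le> card (sym_diff F2 F1 \<union> sym_diff F3 F1)"
    using assms(1,2) finF1 by (intro card_mono) auto
  then have "card (sym_diff F2 F3) \<le> card (sym_diff F2 F1) + card (sym_diff F3 F1)"
    using card_Un_le order_trans by blast
  ultimately show ?thesis by (simp add: algebra_simps)
qed

end
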